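(* Let $G=(V,E)$ be a finite undirected (simple) graph, let $k\ge 1$, and let $A_1,\dots,A_k$ be finite abelian groups with cardinalities $|A_i|=t_i$. Then \begin{align*}\mathrm{Flow}^k_G(A_1,\dots,A_k)&=(-1)^{k|E|}\sum_{(B_i)\in\mathcal{C}^k_E}\ \prod_{i=1}^k(-1)^{|B_i|}t_i^{|B_i|-\mathrm{rk}(B_i)}\\&=(-1)^{k(|E|+\mathrm{rk}(G))}\,T^k_{M(G)}(0,\dots,0;\,1-t_1,\dots,1-t_k).\end{align*}
   Context: Graph notation: for $B\subseteq E$, $c(B)$ is the number of connected components of $(V,B)$, $\mathrm{rk}(B)=|V|-c(B)$, $\mathrm{rk}(G)=\mathrm{rk}(E)$, and $M(G)=(E,\mathrm{rk})$ is the graphic matroid. $\mathcal{C}^k_E=\{(B_1,\dots,B_k)\mid B_1\subseteq\cdots\subseteq B_k\subseteq E\}$ (inclusions need not be strict). Coupled multicommodity flows: fix an orientation $G'=(V,E')$ of $G$ ($E'\subseteq V\times V$ contains exactly one of $(a,b),(b,a)$ for each edge $\{a,b\}\in E$). Groups are written additively. A $k$-tuple $(f_1,\dots,f_k)$ of functions $f_i:E'\to A_i$ is a coupled $k$-multicommodity flow on $G'$ if each $f_i$ satisfies Kirchhoff's first law, $\sum_{j:(v,j)\in E'}f_i(v,j)=\sum_{j:(j,v)\in E'}f_i(j,v)$ for all $v\in V$, and for every $e\in E'$: (i) for every even index $2m$ with $2\le 2m\le k$: if $f_i(e)=0$ for all odd $i$ with $1\le i\le 2m-1$, then $f_{2m}(e)=0$;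 and (ii) if $k$ is odd: if $f_i(e)=0$ for all odd $i$ with $1\le i\le k-2$, then $f_k(e)\neq 0$ (for $k=1$ this reads: $f_1(e)\ne0$ for all $e$, i.e. $f_1$ is a nowhere zero flow). $\mathrm{Flow}^k_G(A_1,\dots,A_k)$ is the number of coupled $k$-multicommodity flows on $G'$ with groups $A_1,\dots,A_k$; this number does not depend on the chosen orientation $G'$. For a matroid $M=(\mathcal{A},\mathrm{rk})$ with $\mathrm{rk}(M)=\mathrm{rk}(\mathcal{A})$, the $k$th chain Tutte polynomial is $T^k_M(x_1,\dots,x_k;y_1,\dots,y_k)=\sum_{S_1\subseteq\cdots\subseteq S_k\subseteq\mathcal{A}}\ \prod_{i=1}^k(x_i-1)^{\mathrm{rk}(M)-\mathrm{rk}(S_i)}(y_i-1)^{|S_i|-\mathrm{rk}(S_i)}$. *)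

theory Defs
  imports "HOL-Algebra.Algebra"
begin

section \<open>Graphs and the graphic matroid\<close>

definition simple_graph :: "'v set \<Rightarrow> 'v set set \<Rightarrow> bool" where
  "simple_graph V E \<longleftrightarrow> finite V \<and> E \<subseteq> {e. e \<subseteq> V \<and> card e = 2}"

definition connected_rel :: "'v set \<Rightarrow> 'v set set \<Rightarrow> ('v \<times> 'v) set" where
  "connected_rel V B = {(u, v). u \<in> V \<and> v \<in> V \<and> (u, v) \<in> {(a, b). {a, b} \<in> B}\<^sup>*}"

definition num_components :: "'v set \<Rightarrow> 'v set set \<Rightarrow> nat" where
  "num_components V B = card (V // connected_rel V B)"

text \<open>The subtraction never truncates for finite \<open>V\<close>, since every component contains a vertex.\<close>

definition rk :: "'v set \<Rightarrow> 'v set set \<Rightarrow> nat" where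
  "rk V B = card V - num_components V B"

text \<open>A matroid is given as a pair of its ground set and its rank function.\<close>

type_synonym 'e matroid = "'e set \<times> ('e set \<Rightarrow> nat)"

definition graphic_matroid :: "'v set \<Rightarrow> 'v set set \<Rightarrow> 'v set matroid" where
  "graphic_matroid V E = (E, rk V)"

section \<open>Chains and the chain Tutte polynomial\<close>

text \<open>Tuples are functions on \<open>{1..k}\<close>, extensional so that each tuple is represented once.\<close>

definition chain_tuples :: "nat \<Rightarrow> 'e set \<Rightarrow> (nat \<Rightarrow> 'e set) set" where
  "chain_tuples k E = {B \<in> {1..k} \<rightarrow>\<^sub>E Pow E. \<forall>i. 1 \<le> i \<and> i < k \<longrightarrow> B i \<subseteq> B (i + 1)}"

text \<open>
  The polynomial is given by its values at points \<open>x\<close>, \<open>y\<close> of an arbitrary commutative ring.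
  For a matroid, \<open>r S \<le> r A\<close> and \<open>r S \<le> card S\<close> for all \<open>S \<subseteq> A\<close>, so the exponents do not truncate.
\<close>

definition chain_Tutte ::
  "nat \<Rightarrow> 'e matroid \<Rightarrow> (nat \<Rightarrow> 'r) \<Rightarrow> (nat \<Rightarrow> 'r) \<Rightarrow> 'r :: comm_ring_1" where
  "chain_Tutte k M x y =
    (case M of (A, r) \<Rightarrow>
      \<Sum>S\<in>chain_tuples k A. \<Prod>i = 1..k.
        (x i - 1) ^ (r A - r (S i)) * (y i - 1) ^ (card (S i) - r (S i)))"

section \<open>Coupled multicommodity flows\<close>

definition orientation :: "'v set \<Rightarrow> 'v set set \<Rightarrow> ('v \<times> 'v) set \<Rightarrow> bool" where
  "orientation V E E' \<longleftrightarrow>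
     E' \<subseteq> V \<times> V \<and>
     (\<forall>a b. (a, b) \<in> E' \<longrightarrow> {a, b} \<in> E) \<and>
     (\<forall>a b. {a, b} \<in> E \<longrightarrow> ((a, b) \<in> E') \<noteq> ((b, a) \<in> E'))"

text \<open>
  Abelian groups are \<^locale>\<open>comm_group\<close> structures and hence written multiplicatively: the zero
  of the additive notation is \<open>\<one>\<close>, and sums are finite products.
\<close>

definition kirchhoff ::
  "'v set \<Rightarrow> ('v \<times> 'v) set \<Rightarrow> ('a, 'b) monoid_scheme \<Rightarrow> ('v \<times> 'v \<Rightarrow> 'a) \<Rightarrow> bool" where
  "kirchhoff V E' A f \<longleftrightarrow>
     (\<forall>v\<in>V. (\<Otimes>\<^bsub>A\<^esub>j\<in>{j. (v, j) \<in> E'}. f (v, j)) = (\<Otimes>\<^bsub>A\<^esub>j\<in>{j. (j, v) \<in> E'}. f (j, v)))"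

definition coupled_flows ::
  "nat \<Rightarrow> 'v set \<Rightarrow> ('v \<times> 'v) set \<Rightarrow> (nat \<Rightarrow> ('a, 'b) monoid_scheme)
    \<Rightarrow> (nat \<Rightarrow> 'v \<times> 'v \<Rightarrow> 'a) set" where
  "coupled_flows k V E' A =
    {f \<in> (\<Pi>\<^sub>E i\<in>{1..k}. E' \<rightarrow>\<^sub>E carrier (A i)).
       (\<forall>i\<in>{1..k}. kirchhoff V E' (A i) (f i)) \<and>
       (\<forall>e\<in>E'.
          (\<forall>m. 2 \<le> 2 * m \<and> 2 * m \<le> k \<longrightarrow>
             (\<forall>i. odd i \<and> 1 \<le> i \<and> i \<le> 2 * m - 1 \<longrightarrow> f i e = \<one>\<^bsub>A i\<^esub>) \<longrightarrow>
             f (2 * m) e = \<one>\<^bsub>A (2 * m)\<^esub>) \<and>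
          (odd k \<longrightarrow>
             (\<forall>i. odd i \<and> 1 \<le> i \<and> i + 2 \<le> k \<longrightarrow> f i e = \<one>\<^bsub>A i\<^esub>) \<longrightarrow>
             f k e \<noteq> \<one>\<^bsub>A k\<^esub>))}"

definition flow_number ::
  "nat \<Rightarrow> 'v set \<Rightarrow> ('v \<times> 'v) set \<Rightarrow> (nat \<Rightarrow> ('a, 'b) monoid_scheme) \<Rightarrow> nat" where
  "flow_number k V E' A = card (coupled_flows k V E' A)"

end

theory Submission
  imports Defs
begin

text \<open>
  The number of flows with values in a group of order \<open>t\<close> and support in \<open>B\<close> is
  \<open>t ^ (card B - rk V B)\<close>: adding an edge to \<open>B\<close> that joins two components
  changes nothing, since a flow vanishes on a bridge; adding an edge that closes a cycle multiplies the
  number by \<open>t\<close>, since flows around the cycle realise every value on the new edge. Hence the chain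
  sum counts, with signs, pairs of a tuple of flows \<open>f\<close> and a chain \<open>B\<close> with
  \<open>f i\<close> supported in \<open>B i\<close>. For fixed \<open>f\<close> the sum over chains
  factors over the edges: an edge \<open>e\<close> may enter the chain at any index up to the first
  \<open>n\<close> with \<open>f n e\<close> nonzero (\<open>n = k + 1\<close> if there is none), which
  contributes an alternating sum equal to \<open>1\<close> if \<open>n\<close> is odd and \<open>0\<close>
  otherwise. The condition that all these \<open>n\<close> are odd says exactly that the flows are coupled.
\<close>

section \<open>The rank of a graph under insertion of an edge\<close>

definition adj :: "'v set set \<Rightarrow> ('v \<times> 'v) set" where
  "adj B = {(a, b). {a, b} \<in> B}"

lemma connected_rel_adj:
  "connected_rel V B = {(u, v). u \<in> V \<and> v \<in> V \<and> (u, v) \<in> (adj B)\<^sup>*}"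
  by (simp add: connected_rel_def adj_def)

lemma sym_rtrancl_adj: "sym ((adj B)\<^sup>*)"
  by (intro sym_rtrancl symI) (auto simp: adj_def insert_commute)

lemma rtrancl_adj_sym: "(x, y) \<in> (adj B)\<^sup>* \<Longrightarrow> (y, x) \<in> (adj B)\<^sup>*"
  by (rule symD[OF sym_rtrancl_adj])

lemma equiv_connected_rel: "equiv V (connected_rel V B)"
proof (rule equivI)
  show "sym (connected_rel V B)"
    using sym_rtrancl_adj[of B] by (auto simp: connected_rel_adj sym_def)
  show "trans (connected_rel V B)"
    by (rule transI) (auto simp: connected_rel_adj intro: rtrancl_trans)
qed (auto simp: connected_rel_adj refl_on_def)

text \<open>A walk can be shortened until it crosses the new edge at most once, in one of the two
  directions.\<close>

lemma rtrancl_adj_insert: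
  "(x, y) \<in> (adj (insert {a, b} B))\<^sup>* \<longleftrightarrow>
     (x, y) \<in> (adj B)\<^sup>* \<or> (x, a) \<in> (adj B)\<^sup>* \<and> (b, y) \<in> (adj B)\<^sup>* \<or>
     (x, b) \<in> (adj B)\<^sup>* \<and> (a, y) \<in> (adj B)\<^sup>*"
proof -
  have "adj (insert {a, b} B) = insert (a, b) (insert (b, a) (adj B))"
    by (auto simp: adj_def doubleton_eq_iff)
  moreover have "(b, a) \<in> (adj B)\<^sup>*" if "(a, b) \<in> (adj B)\<^sup>*"
    using that by (rule rtrancl_adj_sym)
  ultimately show ?thesis
    by (auto simp: rtrancl_insert intro: rtrancl_trans)
qed

section \<open>Counting components\<close>

lemma num_components_le:
  assumes "finite V"
  shows "num_components V B \<le> card V"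
proof -
  have "V // connected_rel V B = (\<lambda>x. connected_rel V B `` {x}) ` V"
    by (auto simp: quotient_def)
  then show ?thesis
    using assms by (simp add: num_components_def card_image_le)
qed

lemma num_components_empty: "num_components V {} = card V"
proof -
  have "V // connected_rel V {} = (\<lambda>x. {x}) ` V"
    by (auto simp: quotient_def connected_rel_adj adj_def)
  then show ?thesis
    by (simp add: num_components_def card_image)
qed

lemma num_components_insert_connected:
  assumes "(a, b) \<in> (adj B)\<^sup>*"
  shows "num_components V (insert {a, b} B) = num_components V B"
proof -
  have "(b, a) \<in> (adj B)\<^sup>*"
    using assms by (rule rtrancl_adj_sym)
  then have "connected_rel V (insert {a, b} B) = connected_rel V B"
    using assms unfolding connected_rel_adj rtrancl_adj_insert
    by (blast intro: rtrancl_trans)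
  then show ?thesis
    by (simp add: num_components_def)
qed

text \<open>The classes of \<open>a\<close> and \<open>b\<close> merge into one, and every other
  class survives unchanged.\<close>

lemma num_components_insert_disconnected:
  assumes "finite V" "a \<in> V" "b \<in> V" and ab: "(a, b) \<notin> (adj B)\<^sup>*"
  shows "num_components V B = Suc (num_components V (insert {a, b} B))"
proof -
  let ?r = "connected_rel V B" and ?r' = "connected_rel V (insert {a, b} B)"
  define Ca Cb where "Ca = ?r `` {a}" and "Cb = ?r `` {b}"
  note eq = equiv_connected_rel[of V B]
  have fin: "finite (V // ?r)"
    using assms(1) by (simp add: quotient_def)
  have in_q: "Ca \<in> V // ?r" "Cb \<in> V // ?r"
    using assms by (auto simp: Ca_def Cb_def intro: quotientI)
  have ne: "Ca \<noteq> Cb"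
    using assms eq_equiv_class_iff[OF eq] by (auto simp: Ca_def Cb_def connected_rel_adj)
  have mem: "a \<in> Ca" "b \<in> Cb"
    using assms by (auto simp: Ca_def Cb_def connected_rel_adj)
  \<comment> \<open>Old classes are equal or disjoint, and the union meets \<open>Ca\<close> in
    \<open>a\<close>.\<close>
  have new: "Ca \<union> Cb \<notin> V // ?r - {Ca, Cb}"
  proof
    assume "Ca \<union> Cb \<in> V // ?r - {Ca, Cb}"
    then have "Ca \<union> Cb \<in> V // ?r" "Ca \<union> Cb \<noteq> Ca" by auto
    with quotient_disj[OF eq, of "Ca \<union> Cb" Ca] in_q mem show False by auto
  qed
  have C_iff: "y \<in> Ca \<longleftrightarrow> y \<in> V \<and> (a, y) \<in> (adj B)\<^sup>*"
    "y \<in> Cb \<longleftrightarrow> y \<in> V \<and> (b, y) \<in> (adj B)\<^sup>*" for y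
    using assms(2,3) by (auto simp: Ca_def Cb_def connected_rel_adj)
  have r'_iff: "y \<in> ?r' `` {x} \<longleftrightarrow> x \<in> V \<and> y \<in> V \<and> ((x, y) \<in> (adj B)\<^sup>* \<or>
      (x, a) \<in> (adj B)\<^sup>* \<and> (b, y) \<in> (adj B)\<^sup>* \<or> (x, b) \<in> (adj B)\<^sup>* \<and> (a, y) \<in> (adj B)\<^sup>*)" for x y
    by (simp add: connected_rel_adj rtrancl_adj_insert)
  have merged: "?r' `` {x} = Ca \<union> Cb" if "x \<in> Ca \<union> Cb" for x
  proof (rule Set.set_eqI)
    fix y
    show "y \<in> ?r' `` {x} \<longleftrightarrow> y \<in> Ca \<union> Cb"
      using that unfolding r'_iff Un_iff C_iff
      by (meson rtrancl_adj_sym rtrancl_trans)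
  qed
  have kept: "?r' `` {x} = ?r `` {x}" if "x \<in> V" "x \<notin> Ca \<union> Cb" for x
  proof (rule Set.set_eqI)
    fix y
    have "(x, a) \<notin> (adj B)\<^sup>*" "(x, b) \<notin> (adj B)\<^sup>*"
      using that by (auto simp: C_iff dest: rtrancl_adj_sym)
    then show "y \<in> ?r' `` {x} \<longleftrightarrow> y \<in> ?r `` {x}"
      unfolding r'_iff by (simp add: connected_rel_adj)
  qed
  have class_eq: "?r `` {x} = Ca \<longleftrightarrow> x \<in> Ca" "?r `` {x} = Cb \<longleftrightarrow> x \<in> Cb" if "x \<in> V" for x
  proof -
    have "?r `` {x} = ?r `` {c} \<longleftrightarrow> (x, c) \<in> ?r" if "c \<in> V" for c
      using eq_equiv_class_iff[OF eq \<open>x \<in> V\<close> that] .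
    moreover have "(x, c) \<in> ?r \<longleftrightarrow> x \<in> ?r `` {c}" for c
      unfolding Image_singleton_iff connected_rel_adj by (auto dest: rtrancl_adj_sym)
    ultimately show "?r `` {x} = Ca \<longleftrightarrow> x \<in> Ca" "?r `` {x} = Cb \<longleftrightarrow> x \<in> Cb"
      using assms(2,3) by (simp_all only: Ca_def Cb_def)
  qed
  have sub: "Ca \<union> Cb \<subseteq> V"
    by (auto simp: Ca_def Cb_def connected_rel_adj)
  have "V // ?r' = (\<lambda>x. ?r' `` {x}) ` (Ca \<union> Cb) \<union> (\<lambda>x. ?r' `` {x}) ` (V - (Ca \<union> Cb))"
    using sub by (auto simp: quotient_def)
  also have "(\<lambda>x. ?r' `` {x}) ` (Ca \<union> Cb) = {Ca \<union> Cb}"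
    using merged mem by (auto simp: image_iff)
  also have "(\<lambda>x. ?r' `` {x}) ` (V - (Ca \<union> Cb)) = (\<lambda>x. ?r `` {x}) ` (V - (Ca \<union> Cb))"
    using kept by (intro image_cong) auto
  also have "\<dots> = V // ?r - {Ca, Cb}"
    using class_eq by (auto simp: quotient_def)
  finally have "V // ?r' = insert (Ca \<union> Cb) (V // ?r - {Ca, Cb})"
    by simp
  then have "card (V // ?r') = Suc (card (V // ?r - {Ca, Cb}))"
    using new fin by simp
  also have "card (V // ?r - {Ca, Cb}) = card (V // ?r) - 2"
    using in_q ne by (subst card_Diff_subset) auto
  finally have "card (V // ?r') = Suc (card (V // ?r) - 2)" .
  \<comment> \<open>Two distinct classes exist, so subtracting 2 from their number does not
    truncate.\<close>
  moreover have "2 \<le> card (V // ?r)"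
    using card_mono[OF fin, of "{Ca, Cb}"] in_q ne by simp
  ultimately show ?thesis
    by (simp add: num_components_def)
qed

text \<open>By \<open>num_components_le\<close> the subtraction in \<open>rk\<close> does not
  truncate, so a lost component is a gained unit of rank. This dichotomy drives the inductions over
  edge sets below.\<close>

lemma rk_insert:
  assumes "finite V" "a \<in> V" "b \<in> V"
  shows "rk V (insert {a, b} B) = rk V B + (if (a, b) \<in> (adj B)\<^sup>* then 0 else 1)"
  using num_components_insert_connected[of a b B V]
    num_components_insert_disconnected[OF assms, of B] num_components_le[OF assms(1), of B]
  by (auto simp: rk_def)

lemma rk_empty: "rk V {} = 0"
  by (simp add: rk_def num_components_empty)

section \<open>Rank in a simple graph\<close>

lemma simple_graphD:
  assumes "simple_graph V E"
  shows "finite V" "finite E" "e \<in> E \<Longrightarrow> \<exists>a\<in>V. \<exists>b\<in>V. a \<noteq> b \<and> e = {a, b}"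
proof -
  show "finite V" using assms by (simp add: simple_graph_def)
  moreover have "E \<subseteq> Pow V" using assms by (auto simp: simple_graph_def)
  ultimately show "finite E" by (meson finite_Pow_iff finite_subset)
  assume "e \<in> E"
  then have "e \<subseteq> V" "card e = 2" using assms by (auto simp: simple_graph_def)
  then show "\<exists>a\<in>V. \<exists>b\<in>V. a \<noteq> b \<and> e = {a, b}" by (auto simp: card_2_iff)
qed

text \<open>The union, in place of an inclusion, lets the induction run over the added edges
  \<open>C\<close> with \<open>B\<close> fixed.\<close>

lemma rk_le_rk_Un:
  assumes "simple_graph V E" "C \<subseteq> E"
  shows "rk V B \<le> rk V (B \<union> C)"
proof -
  have "finite C" using assms simple_graphD(2) finite_subset by blast
  then show ?thesis using \<open>C \<subseteq> E\<close>
  proof induction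
    case (insert e C)
    then obtain a b where "a \<in> V" "b \<in> V" "e = {a, b}"
      using simple_graphD(3)[OF assms(1)] by blast
    then show ?case
      using insert rk_insert[OF simple_graphD(1)[OF assms(1)], of a b "B \<union> C"] by auto
  qed simp
qed

lemma rk_mono:
  assumes "simple_graph V E" "B \<subseteq> E"
  shows "rk V B \<le> rk V E"
  using rk_le_rk_Un[OF assms(1), of E B] assms(2) by (simp add: sup.absorb2)

text \<open>Together with \<open>rk_mono\<close>, this makes the exponents in the chain sum and in
  the Tutte polynomial true differences.\<close>

lemma rk_le_card:
  assumes G: "simple_graph V E" and "B \<subseteq> E"
  shows "rk V B \<le> card B"
proof -
  have "finite B" using assms simple_graphD(2) finite_subset by blast
  then show ?thesis using \<open>B \<subseteq> E\<close>
  proof induction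
    case (insert e B)
    then obtain a b where "a \<in> V" "b \<in> V" "e = {a, b}"
      using simple_graphD(3)[OF G] by blast
    then show ?case
      using insert rk_insert[OF simple_graphD(1)[OF G], of a b B] by auto
  qed (simp add: rk_empty)
qed

section \<open>Flows with prescribed support\<close>

definition und :: "'v \<times> 'v \<Rightarrow> 'v set" where
  "und d = {fst d, snd d}"

text \<open>An orientation picks exactly one arc per edge. The bijection lets supports of flows,
  which consist of arcs, be compared with the edge sets of a chain.\<close>

lemma bij_betw_und:
  assumes "simple_graph V E" "orientation V E D"
  shows "bij_betw und D E"
  unfolding bij_betw_def
proof
  show "inj_on und D"
  proof (rule inj_onI)
    fix d d' assume "d \<in> D" "d' \<in> D" "und d = und d'"
    with assms(2) show "d = d'"
      by (cases d; cases d') (fastforce simp: und_def orientation_def doubleton_eq_iff)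
  qed
  show "und ` D = E"
  proof
    show "und ` D \<subseteq> E"
      using assms(2) by (auto simp: und_def orientation_def)
    show "E \<subseteq> und ` D"
    proof
      fix e assume "e \<in> E"
      then obtain a b where e: "e = {a, b}"
        using simple_graphD(3)[OF assms(1)] by blast
      then have "(a, b) \<in> D \<or> (b, a) \<in> D"
        using assms(2) \<open>e \<in> E\<close> by (auto simp: orientation_def)
      then show "e \<in> und ` D"
        by (force simp: und_def e insert_commute)
    qed
  qed
qed

lemma orientation_finite:
  assumes "simple_graph V E" "orientation V E D"
  shows "finite D"
  using bij_betw_finite[OF bij_betw_und[OF assms]] simple_graphD(2)[OF assms(1)] by simp

text \<open>Flows stay functions on all of \<open>D\<close>, so that the sets for different
  \<open>B\<close> are comparable by inclusion.\<close>

definition flows_on ::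
  "'v set \<Rightarrow> ('v \<times> 'v) set \<Rightarrow> ('a, 'b) monoid_scheme \<Rightarrow> 'v set set \<Rightarrow> ('v \<times> 'v \<Rightarrow> 'a) set" where
  "flows_on V D A B =
     {f \<in> D \<rightarrow>\<^sub>E carrier A. kirchhoff V D A f \<and> (\<forall>d\<in>D. und d \<notin> B \<longrightarrow> f d = \<one>\<^bsub>A\<^esub>)}"

section \<open>Kirchhoff's law as vanishing net outflow\<close>

context comm_group
begin

text \<open>The net outflow at \<open>v\<close>. As a single group element it depends
  multiplicatively on \<open>f\<close>, so flows can be combined and inverted; sums run over arcs
  rather than neighbours.\<close>

definition excess :: "('v \<times> 'v) set \<Rightarrow> ('v \<times> 'v \<Rightarrow> 'a) \<Rightarrow> 'v \<Rightarrow> 'a" where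
  "excess D f v = finprod G f {d \<in> D. fst d = v} \<otimes> inv finprod G f {d \<in> D. snd d = v}"

lemma finprod_sub_closed:
  assumes "f \<in> D \<rightarrow> carrier G"
  shows "finprod G f {d \<in> D. P d} \<in> carrier G"
  using assms by (intro finprod_closed) auto

lemma excess_closed: "f \<in> D \<rightarrow> carrier G \<Longrightarrow> excess D f v \<in> carrier G"
  by (simp add: excess_def finprod_sub_closed)

lemma eq_iff_div_eq_one:
  assumes "x \<in> carrier G" "y \<in> carrier G"
  shows "x = y \<longleftrightarrow> x \<otimes> inv y = \<one>"
  using inv_solve_right[of \<one> x y] assms by auto

lemma kirchhoff_iff_excess:
  assumes f: "f \<in> D \<rightarrow> carrier G"
  shows "kirchhoff V D G f \<longleftrightarrow> (\<forall>v\<in>V. excess D f v = \<one>)"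
proof -
  have out: "(\<Otimes>j\<in>{j. (v, j) \<in> D}. f (v, j)) = finprod G f {d \<in> D. fst d = v}" for v
  proof -
    have eq: "{d \<in> D. fst d = v} = Pair v ` {j. (v, j) \<in> D}" by auto
    show ?thesis unfolding eq
      using f by (intro finprod_reindex[symmetric]) (auto simp: inj_on_def)
  qed
  have inn: "(\<Otimes>j\<in>{j. (j, v) \<in> D}. f (j, v)) = finprod G f {d \<in> D. snd d = v}" for v
  proof -
    have eq: "{d \<in> D. snd d = v} = (\<lambda>j. (j, v)) ` {j. (j, v) \<in> D}" by auto
    show ?thesis unfolding eq
      using f by (intro finprod_reindex[symmetric]) (auto simp: inj_on_def)
  qed
  show ?thesis
    unfolding kirchhoff_def out inn excess_def
    by (intro ball_cong refl eq_iff_div_eq_one finprod_sub_closed[OF f])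
qed

lemma excess_cong:
  assumes "f \<in> D \<rightarrow> carrier G" "\<And>d. d \<in> D \<Longrightarrow> g d = f d"
  shows "excess D g v = excess D f v"
proof -
  have "finprod G g {d \<in> D. P d} = finprod G f {d \<in> D. P d}" for P
    using assms by (intro finprod_cong') auto
  then show ?thesis by (simp add: excess_def)
qed

lemma excess_mult:
  assumes "f \<in> D \<rightarrow> carrier G" "g \<in> D \<rightarrow> carrier G"
  shows "excess D (\<lambda>d. f d \<otimes> g d) v = excess D f v \<otimes> excess D g v"
proof -
  have "finprod G (\<lambda>d. f d \<otimes> g d) {d \<in> D. P d} =
      finprod G f {d \<in> D. P d} \<otimes> finprod G g {d \<in> D. P d}" for P
    using assms by (intro finprod_multf) auto
  moreover have "(x \<otimes> y) \<otimes> inv (x' \<otimes> y') = (x \<otimes> inv x') \<otimes> (y \<otimes> inv y')"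
    if "x \<in> carrier G" "y \<in> carrier G" "x' \<in> carrier G" "y' \<in> carrier G" for x y x' y'
    using that by (simp add: inv_mult m_ac)
  ultimately show ?thesis
    using finprod_sub_closed[OF assms(1)] finprod_sub_closed[OF assms(2)] by (simp add: excess_def)
qed

lemma excess_one: "excess D (\<lambda>d. \<one>) v = \<one>"
  by (simp add: excess_def)

lemma excess_inv:
  assumes f: "f \<in> D \<rightarrow> carrier G"
  shows "excess D (\<lambda>d. inv f d) v = inv excess D f v"
proof -
  have f': "(\<lambda>d. inv f d) \<in> D \<rightarrow> carrier G" using f by auto
  have "excess D (\<lambda>d. inv f d) v \<otimes> excess D f v = excess D (\<lambda>d. inv f d \<otimes> f d) v"
    using excess_mult[OF f' f] by simp
  also have "\<dots> = excess D (\<lambda>d. \<one>) v"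
    using f by (intro excess_cong) (auto simp: Pi_iff)
  finally have "excess D (\<lambda>d. inv f d) v \<otimes> excess D f v = \<one>"
    by (simp add: excess_one)
  then show ?thesis
    using inv_equality[OF _ excess_closed[OF f] excess_closed[OF f']] by simp
qed

section \<open>Flows along a walk\<close>

lemma excess_single:
  assumes "finite D" "d \<in> D" and c: "c \<in> carrier G"
  shows "excess D (\<lambda>e. if e = d then c else \<one>) v =
    (if v = fst d then c else \<one>) \<otimes> inv (if v = snd d then c else \<one>)"
proof -
  have "finprod G (\<lambda>e. if e = d then c else \<one>) {e \<in> D. P e} = (if P d then c else \<one>)" for P
  proof (cases "P d")
    case True
    then show ?thesis
      using assms finprod_singleton_swap[of d "{e \<in> D. P e}" "\<lambda>_. c"] by auto
  next
    case False
    then show ?thesis by (auto intro: finprod_one_eqI)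
  qed
  then show ?thesis by (auto simp: excess_def)
qed

text \<open>Sends \<open>c\<close> along a walk from \<open>a\<close> to \<open>b\<close>, by
  induction on the walk. An arc may be traversed repeatedly, hence each step multiplies the values
  so far by a flow on one arc.\<close>

lemma path_flow:
  assumes D: "finite D" "B \<subseteq> und ` D" and c: "c \<in> carrier G" and "(a, b) \<in> (adj B)\<^sup>*"
  shows "\<exists>g \<in> D \<rightarrow> carrier G. (\<forall>d\<in>D. und d \<notin> B \<longrightarrow> g d = \<one>) \<and>
    (\<forall>v. excess D g v = (if v = a then c else \<one>) \<otimes> inv (if v = b then c else \<one>))"
  using assms(4)
proof induction
  case base
  have "excess D (\<lambda>_. \<one>) v = (if v = a then c else \<one>) \<otimes> inv (if v = a then c else \<one>)" for v
    using c by (simp add: excess_one)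
  then show ?case by (intro bexI[of _ "\<lambda>_. \<one>"]) auto
next
  case (step b b')
  then obtain g where g: "g \<in> D \<rightarrow> carrier G" "\<And>d. d \<in> D \<Longrightarrow> und d \<notin> B \<Longrightarrow> g d = \<one>"
    "\<And>v. excess D g v = (if v = a then c else \<one>) \<otimes> inv (if v = b then c else \<one>)"
    by blast
  from step D have "{b, b'} \<in> B" "{b, b'} \<in> und ` D" by (auto simp: adj_def)
  then obtain d where d: "d \<in> D" "und d \<in> B" "d = (b, b') \<or> d = (b', b)"
    by (auto simp: und_def doubleton_eq_iff)
  \<comment> \<open>The arc may point against the direction of the walk, and then carries the
    inverse.\<close>
  define c' where "c' = (if d = (b, b') then c else inv c)"
  have c': "c' \<in> carrier G" using c by (simp add: c'_def)
  let ?s = "\<lambda>e. if e = d then c' else \<one>"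
  have s: "?s \<in> D \<rightarrow> carrier G" using c' by auto
  have "excess D ?s v = (if v = b then c else \<one>) \<otimes> inv (if v = b' then c else \<one>)" for v
  proof (cases "d = (b, b')")
    case True
    then show ?thesis
      using excess_single[OF D(1) d(1) c', of v] by (simp add: c'_def)
  next
    case False
    then have "d = (b', b)" using d(3) by simp
    then show ?thesis
      using excess_single[OF D(1) d(1) c', of v] False c by (auto simp: c'_def)
  qed
  \<comment> \<open>Telescoping: the sink of the old walk at \<open>b\<close> cancels against the
    source of the new step.\<close>
  moreover have "(x \<otimes> inv y) \<otimes> (y \<otimes> inv z) = x \<otimes> inv z"
    if "x \<in> carrier G" "y \<in> carrier G" "z \<in> carrier G" for x y z
  proof -
    have "inv y \<otimes> (y \<otimes> inv z) = inv z"
      using that by (simp add: m_assoc[symmetric])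
    then show ?thesis
      using that by (simp add: m_assoc)
  qed
  ultimately have "excess D (\<lambda>e. g e \<otimes> ?s e) v =
      (if v = a then c else \<one>) \<otimes> inv (if v = b' then c else \<one>)" for v
    using excess_mult[OF g(1) s, of v] g(3)[of v] c by auto
  moreover have "(\<lambda>e. g e \<otimes> ?s e) \<in> D \<rightarrow> carrier G" using g(1) s by auto
  moreover have "g e \<otimes> ?s e = \<one>" if "e \<in> D" "und e \<notin> B" for e
    using g(2)[OF that] that(2) d(2) by auto
  ultimately show ?case by (intro bexI[of _ "\<lambda>e. g e \<otimes> ?s e"]) blast+
qed

section \<open>Group structure on flows with given support\<close>

lemma flows_on_iff:
  "f \<in> flows_on V D G B \<longleftrightarrow> f \<in> D \<rightarrow>\<^sub>E carrier G \<and> (\<forall>v\<in>V. excess D f v = \<one>) \<and>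
     (\<forall>d\<in>D. und d \<notin> B \<longrightarrow> f d = \<one>)"
  using kirchhoff_iff_excess[of f D V] by (auto simp: flows_on_def PiE_def)

lemma flows_onI:
  assumes "f \<in> D \<rightarrow> carrier G" "\<And>v. v \<in> V \<Longrightarrow> excess D f v = \<one>"
    and "\<And>d. d \<in> D \<Longrightarrow> und d \<notin> B \<Longrightarrow> f d = \<one>"
  shows "restrict f D \<in> flows_on V D G B"
  using assms excess_cong[OF assms(1), of "restrict f D"] by (auto simp: flows_on_iff)

lemma flows_on_mult:
  assumes "f \<in> flows_on V D G B" "g \<in> flows_on V D G B"
  shows "(\<lambda>d\<in>D. f d \<otimes> g d) \<in> flows_on V D G B"
proof (rule flows_onI)
  have fg: "f \<in> D \<rightarrow> carrier G" "g \<in> D \<rightarrow> carrier G"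
    using assms by (auto simp: flows_on_iff)
  then show "(\<lambda>d. f d \<otimes> g d) \<in> D \<rightarrow> carrier G" by auto
  show "excess D (\<lambda>d. f d \<otimes> g d) v = \<one>" if "v \<in> V" for v
    using assms that excess_mult[OF fg] by (simp add: flows_on_iff)
qed (use assms in \<open>auto simp: flows_on_iff\<close>)

lemma flows_on_inv:
  assumes "f \<in> flows_on V D G B"
  shows "(\<lambda>d\<in>D. inv f d) \<in> flows_on V D G B"
proof (rule flows_onI)
  have f: "f \<in> D \<rightarrow> carrier G"
    using assms by (auto simp: flows_on_iff)
  then show "(\<lambda>d. inv f d) \<in> D \<rightarrow> carrier G" by auto
  show "excess D (\<lambda>d. inv f d) v = \<one>" if "v \<in> V" for v
    using assms that excess_inv[OF f] by (simp add: flows_on_iff)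
qed (use assms in \<open>auto simp: flows_on_iff\<close>)

lemma flows_on_mono: "B \<subseteq> B' \<Longrightarrow> flows_on V D G B \<subseteq> flows_on V D G B'"
  by (auto simp: flows_on_def)

text \<open>Kirchhoff's law multiplied over all vertices of \<open>C\<close>.\<close>

lemma cut_balance:
  assumes "finite D" "finite C" and f: "f \<in> D \<rightarrow> carrier G"
    and "\<And>v. v \<in> C \<Longrightarrow> excess D f v = \<one>"
  shows "finprod G f {d \<in> D. fst d \<in> C} = finprod G f {d \<in> D. snd d \<in> C}"
proof -
  \<comment> \<open>Needed for \<open>p = fst\<close> and \<open>p = snd\<close>: arcs are sorted by
    their tail or by their head.\<close>
  have split: "finprod G f {d \<in> D. p d \<in> C} = (\<Otimes>v\<in>C. finprod G f {d \<in> D. p d = v})"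
    for p :: "'c \<times> 'c \<Rightarrow> 'c"
  proof -
    have eq: "{d \<in> D. p d \<in> C} = (\<Union>v\<in>C. {d \<in> D. p d = v})" by auto
    show ?thesis unfolding eq
    proof (rule finprod_UN_disjoint)
      show "pairwise (\<lambda>u v. disjnt {d \<in> D. p d = u} {d \<in> D. p d = v}) C"
        by (auto simp: pairwise_def disjnt_def)
    qed (use assms(1,2) f in auto)
  qed
  have at_vertex: "finprod G f {d \<in> D. fst d = v} = finprod G f {d \<in> D. snd d = v}"
    if "v \<in> C" for v
    using assms(4)[OF that] unfolding excess_def
    by (subst eq_iff_div_eq_one[OF finprod_sub_closed[OF f] finprod_sub_closed[OF f]])
  show ?thesis
    unfolding split[of fst] split[of snd]
    by (intro finprod_cong'[OF refl] Pi_I at_vertex finprod_sub_closed[OF f])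
qed

text \<open>In the balance of the cut, arcs inside \<open>C\<close> occur on both sides and cancel.
  Among the crossing arcs only \<open>h\<close> can carry a nontrivial value, and it occurs on one
  side only.\<close>

lemma flow_vanishes_on_bridge:
  assumes "finite D" "finite C" and f: "f \<in> D \<rightarrow> carrier G"
    and bal: "\<And>v. v \<in> C \<Longrightarrow> excess D f v = \<one>"
    and h: "h \<in> D" "(fst h \<in> C) \<noteq> (snd h \<in> C)"
    and others: "\<And>d. d \<in> D \<Longrightarrow> d \<noteq> h \<Longrightarrow> (fst d \<in> C) \<noteq> (snd d \<in> C) \<Longrightarrow> f d = \<one>"
  shows "f h = \<one>"
proof -
  let ?I = "{d \<in> D. fst d \<in> C \<and> snd d \<in> C}"
  have hG: "f h \<in> carrier G" using f h by auto
  have I: "finprod G f ?I \<in> carrier G" by (rule finprod_sub_closed[OF f])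
  have ins: "finprod G f (insert h ?I) = f h \<otimes> finprod G f ?I"
    using assms(1) h f hG by (intro finprod_insert) auto
  have side: "finprod G f {d \<in> D. p d \<in> C} =
      (if p h \<in> C then f h \<otimes> finprod G f ?I else finprod G f ?I)"
    if "p = fst \<or> p = snd" for p :: "'c \<times> 'c \<Rightarrow> 'c"
  proof (cases "p h \<in> C")
    case True
    have "finprod G f {d \<in> D. p d \<in> C} = finprod G f (insert h ?I)"
      using that True f h assms(1) others
      by (intro finprod_mono_neutral_cong_right) auto
    then show ?thesis using True ins by simp
  next
    case False
    have "finprod G f {d \<in> D. p d \<in> C} = finprod G f ?I"
      using that False f h assms(1) others
      by (intro finprod_mono_neutral_cong_right) auto
    then show ?thesis using False by simp
  qed
  have "f h \<otimes> finprod G f ?I = finprod G f ?I"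
    using cut_balance[OF assms(1,2) f bal] side[of fst] side[of snd] h(2)
    by (cases "fst h \<in> C") auto
  then show ?thesis using hG I by simp
qed

text \<open>The new edge is a bridge, so a flow is trivial on it.\<close>

lemma flows_on_insert_disconnected:
  assumes G: "simple_graph V E" and D: "orientation V E D" and "insert {a, b} B \<subseteq> E"
    and ab: "a \<in> V" "b \<in> V" "(a, b) \<notin> (adj B)\<^sup>*"
  shows "flows_on V D G (insert {a, b} B) = flows_on V D G B"
proof
  show "flows_on V D G (insert {a, b} B) \<subseteq> flows_on V D G B"
  proof
    fix f assume f: "f \<in> flows_on V D G (insert {a, b} B)"
    have bij: "bij_betw und D E" using G D by (rule bij_betw_und)
    then obtain h where h: "h \<in> D" "und h = {a, b}"
      using assms(3) by (auto simp: bij_betw_def)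
    \<comment> \<open>The component of \<open>a\<close> in \<open>B\<close>: the new edge leaves it,
      and no edge of \<open>B\<close> does.\<close>
    define C where "C = {v \<in> V. (a, v) \<in> (adj B)\<^sup>*}"
    have ends: "fst d \<in> V" "snd d \<in> V" if "d \<in> D" for d
      using that D by (auto simp: orientation_def)
    have "f h = \<one>"
    proof (rule flow_vanishes_on_bridge[where D = D and C = C])
      show "finite D" using G D by (rule orientation_finite)
      show "finite C" using simple_graphD(1)[OF G] by (simp add: C_def)
      show "(fst h \<in> C) \<noteq> (snd h \<in> C)"
        using h(2) ab by (auto simp: und_def C_def doubleton_eq_iff)
      fix d assume d: "d \<in> D" "d \<noteq> h" and cross: "(fst d \<in> C) \<noteq> (snd d \<in> C)"
      have "und d \<noteq> {a, b}"
        using bij h d by (auto simp: bij_betw_def inj_on_def)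
      moreover have "und d \<notin> B"
      proof
        assume "und d \<in> B"
        then have "(fst d, snd d) \<in> adj B" "(snd d, fst d) \<in> adj B"
          by (auto simp: adj_def und_def insert_commute)
        then show False
          using cross ends[OF d(1)] by (auto simp: C_def intro: rtrancl_into_rtrancl)
      qed
      ultimately show "f d = \<one>" using f d by (auto simp: flows_on_iff)
    qed (use f h in \<open>auto simp: flows_on_iff C_def\<close>)
    moreover have "d = h" if "d \<in> D" "und d = {a, b}" for d
      using that h bij by (auto simp: bij_betw_def inj_on_def)
    ultimately show "f \<in> flows_on V D G B"
      using f by (auto simp: flows_on_iff)
  qed
qed (auto intro: flows_on_mono[THEN subsetD])

text \<open>A path flow of value \<open>c\<close> from the head of \<open>h\<close> back to its tail
  is closed up by putting \<open>c\<close> on \<open>h\<close>.\<close>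

lemma cycle_flow:
  assumes G: "simple_graph V E" and D: "orientation V E D" and "B \<subseteq> E"
    and h: "h \<in> D" "und h \<notin> B" "(snd h, fst h) \<in> (adj B)\<^sup>*" and c: "c \<in> carrier G"
  shows "\<exists>z \<in> flows_on V D G (insert (und h) B). z h = c"
proof -
  have fin: "finite D" using G D by (rule orientation_finite)
  have "B \<subseteq> und ` D" using bij_betw_und[OF G D] assms(3) by (auto simp: bij_betw_def)
  from path_flow[OF fin this c h(3)] obtain g where g: "g \<in> D \<rightarrow> carrier G"
    "\<And>d. d \<in> D \<Longrightarrow> und d \<notin> B \<Longrightarrow> g d = \<one>"
    "\<And>v. excess D g v = (if v = snd h then c else \<one>) \<otimes> inv (if v = fst h then c else \<one>)"
    by blast
  let ?s = "\<lambda>e. if e = h then c else \<one>"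
  have s: "?s \<in> D \<rightarrow> carrier G" using c by auto
  have "(\<lambda>e\<in>D. g e \<otimes> ?s e) \<in> flows_on V D G (insert (und h) B)"
  proof (rule flows_onI)
    show "(\<lambda>e. g e \<otimes> ?s e) \<in> D \<rightarrow> carrier G" using g(1) s by auto
    show "excess D (\<lambda>e. g e \<otimes> ?s e) v = \<one>" for v
      using excess_mult[OF g(1) s, of v] g(3) excess_single[OF fin h(1) c] c by simp
  qed (use g(2) in auto)
  \<comment> \<open>The path flow is trivial on \<open>h\<close>, since its support lies in
    \<open>B\<close>.\<close>
  moreover have "(\<lambda>e\<in>D. g e \<otimes> ?s e) h = c" using g(2) h c by simp
  ultimately show ?thesis by blast
qed

text \<open>Evaluation at the new arc \<open>h\<close> maps the larger set of flows onto the group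
  with kernel the smaller one. The count comes from an explicit bijection built from a section of
  this map.\<close>

lemma card_flows_on_insert_connected:
  assumes G: "simple_graph V E" and D: "orientation V E D" and B: "insert {a, b} B \<subseteq> E"
    and new: "{a, b} \<notin> B" and ab: "(a, b) \<in> (adj B)\<^sup>*"
  shows "card (flows_on V D G (insert {a, b} B)) = card (flows_on V D G B) * order G"
proof -
  let ?F = "flows_on V D G B" and ?F' = "flows_on V D G (insert {a, b} B)"
  have bij: "bij_betw und D E" using G D by (rule bij_betw_und)
  then obtain h where h: "h \<in> D" "und h = {a, b}"
    using B by (auto simp: bij_betw_def)
  then have "(snd h, fst h) \<in> (adj B)\<^sup>*"
    using ab rtrancl_adj_sym[OF ab] by (auto simp: und_def doubleton_eq_iff)
  then have "\<forall>c\<in>carrier G. \<exists>z. z \<in> ?F' \<and> z h = c"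
    using cycle_flow[OF G D, of B h] B h new by auto
  \<comment> \<open>An arbitrary section of evaluation at \<open>h\<close>; it need not be a
    homomorphism.\<close>
  then obtain z where z: "\<And>c. c \<in> carrier G \<Longrightarrow> z c \<in> ?F'"
    "\<And>c. c \<in> carrier G \<Longrightarrow> z c h = c"
    by metis
  have zG: "z c d \<in> carrier G" if "c \<in> carrier G" "d \<in> D" for c d
    using z(1)[OF that(1)] that(2) by (auto simp: flows_on_iff)
  have FG: "f d \<in> carrier G" if "f \<in> ?F'" "d \<in> D" for f d
    using that by (auto simp: flows_on_iff)
  have sub: "?F \<subseteq> ?F'" by (rule flows_on_mono) auto
  have Fh: "f h = \<one>" if "f \<in> ?F" for f
    using that h new by (auto simp: flows_on_iff)
  have F'_F: "f \<in> ?F" if "f \<in> ?F'" "f h = \<one>" for f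
  proof -
    have "d = h" if "d \<in> D" "und d = {a, b}" for d
      using that h bij by (auto simp: bij_betw_def inj_on_def)
    then show ?thesis using that by (auto simp: flows_on_iff)
  qed
  have ext: "f = g" if "f \<in> ?F'" "g \<in> ?F'" "\<And>d. d \<in> D \<Longrightarrow> f d = g d" for f g
    using that by (intro PiE_ext[of f D _ g]) (auto simp: flows_on_iff)
  let ?up = "\<lambda>(f, c). \<lambda>d\<in>D. f d \<otimes> z c d"
  let ?down = "\<lambda>f. (\<lambda>d\<in>D. f d \<otimes> inv z (f h) d, f h)"
  have up: "?up (f, c) \<in> ?F'" if "f \<in> ?F" "c \<in> carrier G" for f c
    using flows_on_mult[of f V D _ "z c"] that z(1) sub by auto
  have down: "fst (?down f) \<in> ?F" if f: "f \<in> ?F'" for f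
  proof (rule F'_F)
    have c: "f h \<in> carrier G" using FG f h by simp
    \<comment> \<open>The nested restriction matches the forms in \<open>flows_on_mult\<close> and
      \<open>flows_on_inv\<close>; it is simplified away next.\<close>
    have "(\<lambda>d\<in>D. f d \<otimes> (\<lambda>d\<in>D. inv z (f h) d) d) \<in> ?F'"
      using f z(1)[OF c] by (intro flows_on_mult flows_on_inv)
    moreover have "(\<lambda>d\<in>D. f d \<otimes> (\<lambda>d\<in>D. inv z (f h) d) d) = fst (?down f)"
      by auto
    ultimately show "fst (?down f) \<in> ?F'" by simp
    show "fst (?down f) h = \<one>" using c z(2) h by simp
  qed
  have "bij_betw ?up (?F \<times> carrier G) ?F'"
  proof (rule bij_betw_byWitness[where f' = ?down])
    show "\<forall>x\<in>?F \<times> carrier G. ?down (?up x) = x"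
    proof (rule ballI)
      fix x assume "x \<in> ?F \<times> carrier G"
      then obtain f c where x: "x = (f, c)" and f: "f \<in> ?F" and c: "c \<in> carrier G" by blast
      have "?up (f, c) h = c" using Fh[OF f] z(2)[OF c] c h by simp
      moreover have "fst (?down (?up (f, c))) = f"
      proof (rule ext)
        show "fst (?down (?up (f, c))) \<in> ?F'" using down[OF up[OF f c]] sub by blast
        show "f \<in> ?F'" using f sub by blast
        fix d assume d: "d \<in> D"
        have "f d \<in> carrier G" using FG f sub d by blast
        then show "fst (?down (?up (f, c))) d = f d"
          using Fh[OF f] z(2)[OF c] c h zG[OF c] d by (simp add: m_assoc)
      qed
      ultimately show "?down (?up x) = x" by (simp add: x)
    qed
    show "\<forall>f\<in>?F'. ?up (?down f) = f"
    proof
      fix f assume f: "f \<in> ?F'"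
      have c: "f h \<in> carrier G" using FG f h by simp
      show "?up (?down f) = f"
      proof (rule ext)
        show "?up (?down f) \<in> ?F'" using up[OF down[OF f] c] by simp
        show "?up (?down f) d = f d" if "d \<in> D" for d
          using that FG[OF f] zG[OF c] by (simp add: m_assoc)
      qed (rule f)
    qed
    show "?up ` (?F \<times> carrier G) \<subseteq> ?F'" using up by blast
    show "?down ` ?F' \<subseteq> ?F \<times> carrier G" using down FG[OF _ h(1)] by auto
  qed
  then have "card ?F' = card (?F \<times> carrier G)" by (simp add: bij_betw_same_card)
  then show ?thesis by (simp add: card_cartesian_product order_def)
qed

section \<open>The number of flows with given support\<close>

lemma flows_on_empty: "flows_on V D G {} = {\<lambda>d\<in>D. \<one>}"
proof
  show "flows_on V D G {} \<subseteq> {\<lambda>d\<in>D. \<one>}"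
    by (auto simp: flows_on_def PiE_iff extensional_def restrict_def)
  show "{\<lambda>d\<in>D. \<one>} \<subseteq> flows_on V D G {}"
    by (auto intro!: flows_onI simp: excess_one)
qed

text \<open>Edges are added one at a time. A bridge raises cardinality and rank together; an edge
  closing a cycle raises only the cardinality, matching the extra factor
  \<open>order G\<close>.\<close>

lemma card_flows_on:
  assumes G: "simple_graph V E" and D: "orientation V E D" and "B \<subseteq> E"
  shows "card (flows_on V D G B) = order G ^ (card B - rk V B)"
proof -
  have "finite B" using assms simple_graphD(2) finite_subset by blast
  then show ?thesis using \<open>B \<subseteq> E\<close>
  proof induction
    case empty
    show ?case by (simp add: rk_empty flows_on_empty)
  next
    case (insert e B)
    then obtain a b where ab: "a \<in> V" "b \<in> V" "e = {a, b}"
      using simple_graphD(3)[OF G] by blast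
    note rk = rk_insert[OF simple_graphD(1)[OF G] ab(1,2), of B]
    show ?case
    proof (cases "(a, b) \<in> (adj B)\<^sup>*")
      case True
      then show ?thesis
        using insert rk ab card_flows_on_insert_connected[OF G D, of a b B] rk_le_card[OF G, of B]
        by (simp add: Suc_diff_le)
    next
      case False
      then show ?thesis
        using insert rk ab flows_on_insert_disconnected[OF G D, of a b B] by simp
    qed
  qed
qed

end

section \<open>Signed sums over chains\<close>

text \<open>
  A chain is encoded by the index at which each edge enters it, with \<open>Suc k\<close> for an edge that never does.
\<close>

lemma chain_tuples_thresholds:
  fixes p :: "nat \<Rightarrow> 'e \<Rightarrow> bool"
  shows "bij_betw (\<lambda>j. \<lambda>i\<in>{1..k}. {e \<in> E. j e \<le> i})
     (\<Pi>\<^sub>E e\<in>E. {j \<in> {1..Suc k}. \<forall>i\<in>{1..k}. p i e \<longrightarrow> j \<le> i})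
     {B \<in> chain_tuples k E. \<forall>i\<in>{1..k}. {e \<in> E. p i e} \<subseteq> B i}"
  (is "bij_betw ?T ?J ?C")
  unfolding bij_betw_def
proof
  show "inj_on ?T ?J"
  proof (rule inj_onI, rule PiE_ext)
    fix j j' e assume j: "j \<in> ?J" "j' \<in> ?J" and eq: "?T j = ?T j'" and e: "e \<in> E"
    have range: "j e \<in> {1..Suc k}" "j' e \<in> {1..Suc k}"
      using j e by auto
    have "j e \<le> i \<longleftrightarrow> j' e \<le> i" if "i \<in> {1..k}" for i
      using fun_cong[OF eq, of i] that e by auto
    \<comment> \<open>Each threshold is tested against the other. The value \<open>Suc k\<close>
      lies outside the tested range, hence the case split.\<close>
    from this[of "j e"] this[of "j' e"] show "j e = j' e"
      using range by (cases "j e = Suc k"; cases "j' e = Suc k") auto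
  qed
  show "?T ` ?J = ?C"
  proof
    show "?T ` ?J \<subseteq> ?C"
    proof
      fix B assume "B \<in> ?T ` ?J"
      then obtain j where j: "j \<in> ?J" and B: "B = ?T j" by blast
      have "B \<in> chain_tuples k E"
        by (auto simp: B chain_tuples_def)
      moreover have "{e \<in> E. p i e} \<subseteq> B i" if "i \<in> {1..k}" for i
        using that PiE_mem[OF j] by (auto simp: B)
      ultimately show "B \<in> ?C" by blast
    qed
    show "?C \<subseteq> ?T ` ?J"
    proof
      fix B assume B: "B \<in> ?C"
      have mono: "B i \<subseteq> B i'" if "i \<le> i'" "1 \<le> i" "i' \<le> k" for i i'
        using that
      proof (induction rule: dec_induct)
        case (step n)
        then have "B i \<subseteq> B n" by simp
        also have "B n \<subseteq> B (Suc n)" using B step by (simp add: chain_tuples_def)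
        finally show ?case .
      qed simp
      \<comment> \<open>The disjunct \<open>i = Suc k\<close> guarantees a least index for edges
        that never enter the chain.\<close>
      define P where "P e i \<longleftrightarrow> i = Suc k \<or> 1 \<le> i \<and> i \<le> k \<and> e \<in> B i" for e i
      define j where "j = (\<lambda>e\<in>E. LEAST i. P e i)"
      have P: "P e (j e)" if "e \<in> E" for e
        using LeastI[of "P e" "Suc k"] that by (simp add: j_def P_def)
      have least: "j e \<le> i" if "e \<in> E" "P e i" for e i
        using Least_le[of "P e" i] that by (simp add: j_def)
      have iff: "e \<in> B i \<longleftrightarrow> j e \<le> i" if "e \<in> E" "i \<in> {1..k}" for e i
      proof
        assume "e \<in> B i"
        then show "j e \<le> i" using least[OF that(1)] that(2) by (simp add: P_def)
      next
        assume "j e \<le> i"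
        then have "1 \<le> j e" "e \<in> B (j e)" using P[OF that(1)] that(2) by (auto simp: P_def)
        then show "e \<in> B i" using mono \<open>j e \<le> i\<close> that(2) by auto
      qed
      have "?T j = B"
      proof
        fix i
        show "?T j i = B i"
        proof (cases "i \<in> {1..k}")
          case True
          then have "B i \<subseteq> E" using B by (auto simp: chain_tuples_def)
          then show ?thesis using True iff by auto
        next
          case False
          then show ?thesis using B by (auto simp: chain_tuples_def PiE_iff extensional_def)
        qed
      qed
      moreover have "j \<in> ?J"
      proof (rule PiE_I)
        fix e assume e: "e \<in> E"
        have "j e \<le> i" if "i \<in> {1..k}" "p i e" for i
          using B e that iff[OF e] by blast
        then show "j e \<in> {j \<in> {1..Suc k}. \<forall>i\<in>{1..k}. p i e \<longrightarrow> j \<le> i}"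
          using P[OF e] by (auto simp: P_def)
      qed (simp add: j_def)
      ultimately show "B \<in> ?T ` ?J"
        by blast
    qed
  qed
qed

section \<open>The first nonzero index and its parity\<close>

definition first_index :: "nat \<Rightarrow> (nat \<Rightarrow> bool) \<Rightarrow> nat" where
  "first_index k p = (LEAST i. i = Suc k \<or> 1 \<le> i \<and> p i)"

lemma first_index:
  shows "1 \<le> first_index k p" "first_index k p \<le> Suc k"
    and "first_index k p \<le> k \<Longrightarrow> p (first_index k p)"
    and "\<And>i. 1 \<le> i \<Longrightarrow> p i \<Longrightarrow> first_index k p \<le> i"
proof -
  let ?Q = "\<lambda>i. i = Suc k \<or> 1 \<le> i \<and> p i"
  \<comment> \<open>The default \<open>Suc k\<close> satisfies \<open>?Q\<close>, so the least
    element exists and never exceeds it.\<close>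
  have *: "?Q (first_index k p)"
    unfolding first_index_def by (rule LeastI[of ?Q "Suc k"]) simp
  then show "1 \<le> first_index k p" "first_index k p \<le> k \<Longrightarrow> p (first_index k p)"
    by auto
  show "first_index k p \<le> Suc k" "\<And>i. 1 \<le> i \<Longrightarrow> p i \<Longrightarrow> first_index k p \<le> i"
    unfolding first_index_def by (auto intro: Least_le)
qed

text \<open>An even first index \<open>2 * m\<close> up to \<open>k\<close> violates the clause on
  even indices. The default \<open>Suc k\<close> is even exactly when \<open>k\<close> is odd, and
  then violates the last clause. Both clauses inspect earlier odd indices only, which suffices
  because an odd first index is among those.\<close>

lemma odd_first_index_iff:
  "odd (first_index k p) \<longleftrightarrow>
     (\<forall>m. 2 \<le> 2 * m \<and> 2 * m \<le> k \<longrightarrow>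
        (\<forall>i. odd i \<and> 1 \<le> i \<and> i \<le> 2 * m - 1 \<longrightarrow> \<not> p i) \<longrightarrow> \<not> p (2 * m)) \<and>
     (odd k \<longrightarrow> (\<forall>i. odd i \<and> 1 \<le> i \<and> i + 2 \<le> k \<longrightarrow> \<not> p i) \<longrightarrow> p k)"
  (is "_ \<longleftrightarrow> ?even \<and> ?last")
proof
  let ?n = "first_index k p"
  assume odd: "odd ?n"
  have ?even
  proof (intro allI impI notI)
    fix m assume m: "2 \<le> 2 * m \<and> 2 * m \<le> k"
      and z: "\<forall>i. odd i \<and> 1 \<le> i \<and> i \<le> 2 * m - 1 \<longrightarrow> \<not> p i" and "p (2 * m)"
    then have "?n \<le> 2 * m" using first_index(4)[of "2 * m" p k] by simp
    moreover have "?n \<noteq> 2 * m" using odd by (metis even_mult_iff even_numeral)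
    ultimately have "?n \<le> 2 * m - 1" "?n \<le> k" using m by linarith+
    then show False using z odd first_index(1)[of k p] first_index(3)[of k p] by blast
  qed
  moreover have ?last
  proof (intro impI)
    assume "odd k" and z: "\<forall>i. odd i \<and> 1 \<le> i \<and> i + 2 \<le> k \<longrightarrow> \<not> p i"
    have "?n \<noteq> Suc k" using odd \<open>odd k\<close> by auto
    then have n: "?n \<le> k" using first_index(2)[of k p] by linarith
    then have "p ?n" by (rule first_index(3))
    \<comment> \<open>Only \<open>k - 1\<close> and \<open>k\<close> remain for the first index, and
      parity excludes the former.\<close>
    then have "\<not> ?n + 2 \<le> k" using z odd first_index(1)[of k p] by blast
    moreover have "Suc ?n \<noteq> k" using odd \<open>odd k\<close> by (metis even_Suc)
    ultimately have "?n = k" using n by linarith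
    then show "p k" using \<open>p ?n\<close> by simp
  qed
  ultimately show "?even \<and> ?last" ..
next
  let ?n = "first_index k p"
  assume *: "?even \<and> ?last"
  have below: "\<not> p i" if "i < ?n" "1 \<le> i" for i
    using first_index(4)[of i p k] that by linarith
  show "odd ?n"
  proof
    assume even: "even ?n"
    then obtain m where m: "?n = 2 * m" by (auto elim: evenE)
    show False
    proof (cases "?n \<le> k")
      case True
      have "\<not> p (2 * m)"
        using * True first_index(1)[of k p] below m by auto
      then show False using first_index(3)[OF True] m by simp
    next
      case False
      then have n: "?n = Suc k" using first_index(2)[of k p] by linarith
      with even have "odd k" by simp
      then have "p k" using * below n by auto
      moreover have "1 \<le> k" using \<open>odd k\<close> by (cases k) auto
      ultimately show False using below[of k] n by simp
    qed
  qed
qed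

lemma sum_alternating: "(\<Sum>j = 1..m. (-1) ^ (j - 1)) = (if odd m then 1 else 0 :: int)"
  by (induction m) auto

text \<open>The contribution of one edge. The admissible thresholds run from 1 to the first index,
  and together with \<open>(-1) ^ k\<close> the threshold \<open>j\<close> has sign
  \<open>(-1) ^ (j - 1)\<close>.\<close>

lemma threshold_sum:
  "(-1) ^ k * (\<Sum>j | j \<in> {1..Suc k} \<and> (\<forall>i\<in>{1..k}. p i \<longrightarrow> j \<le> i).
      \<Prod>i = 1..k. if j \<le> i then -1 else 1) = (if odd (first_index k p) then 1 else 0 :: int)"
proof -
  let ?n = "first_index k p"
  have range: "{j. j \<in> {1..Suc k} \<and> (\<forall>i\<in>{1..k}. p i \<longrightarrow> j \<le> i)} = {1..?n}" (is "?J = _")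
  proof
    show "?J \<subseteq> {1..?n}"
    proof
      fix j assume j: "j \<in> ?J"
      then have "j \<le> ?n"
        using first_index(1-3)[of k p] by (cases "?n \<le> k") auto
      with j show "j \<in> {1..?n}" by simp
    qed
    show "{1..?n} \<subseteq> ?J"
    proof
      fix j assume j: "j \<in> {1..?n}"
      have "j \<le> i" if "i \<in> {1..k}" "p i" for i
        using first_index(4)[of i p k] that j by simp
      then show "j \<in> ?J" using j first_index(2)[of k p] by auto
    qed
  qed
  have sign: "(-1) ^ k * (\<Prod>i = 1..k. if j \<le> i then -1 else 1) = (-1 :: int) ^ (j - 1)"
    if "j \<in> {1..?n}" for j
  proof -
    have j: "1 \<le> j" "j \<le> Suc k" using that first_index(2)[of k p] by auto
    have "(-1) ^ k * (\<Prod>i = 1..k. if j \<le> i then -1 else 1 :: int) =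
        (\<Prod>i = 1..k. -1) * (\<Prod>i = 1..k. if j \<le> i then -1 else 1)"
      by simp
    \<comment> \<open>Distributing \<open>(-1) ^ k\<close> over the indices flips every sign, which
      moves the factors -1 from \<open>j \<le> i\<close> to \<open>i < j\<close> and leaves
      \<open>j - 1\<close> of them.\<close>
    also have "\<dots> = (\<Prod>i = 1..k. if i \<in> {1..<j} then -1 else 1)"
      unfolding prod.distrib[symmetric] by (intro prod.cong) auto
    also have "\<dots> = (\<Prod>i \<in> {1..k} \<inter> {1..<j}. -1)"
      by (subst prod.inter_restrict) auto
    also have "{1..k} \<inter> {1..<j} = {1..<j}"
      using j by auto
    finally show ?thesis by simp
  qed
  show ?thesis
    unfolding range sum_distrib_left sum_alternating[symmetric]
    by (intro sum.cong refl sign)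
qed

text \<open>Thresholds of different edges are independent, so the sum over chains is a product over
  edges of the sums in \<open>threshold_sum\<close>; each edge takes its share
  \<open>(-1) ^ k\<close> of the sign.\<close>

lemma signed_chain_sum:
  fixes p :: "nat \<Rightarrow> 'e \<Rightarrow> bool"
  assumes E: "finite E"
  shows "(-1) ^ (k * card E) *
      (\<Sum>B | B \<in> chain_tuples k E \<and> (\<forall>i\<in>{1..k}. {e \<in> E. p i e} \<subseteq> B i).
         \<Prod>i = 1..k. (-1) ^ card (B i)) =
    (if \<forall>e\<in>E. odd (first_index k (\<lambda>i. p i e)) then 1 else 0 :: int)"
proof -
  let ?J = "\<lambda>e. {j \<in> {1..Suc k}. \<forall>i\<in>{1..k}. p i e \<longrightarrow> j \<le> i}"
  have "(\<Sum>B | B \<in> chain_tuples k E \<and> (\<forall>i\<in>{1..k}. {e \<in> E. p i e} \<subseteq> B i).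
         \<Prod>i = 1..k. (-1) ^ card (B i)) =
      (\<Sum>j\<in>Pi\<^sub>E E ?J. \<Prod>i = 1..k. (-1 :: int) ^ card {e \<in> E. j e \<le> i})"
    by (subst sum.reindex_bij_betw[OF chain_tuples_thresholds, symmetric])
      (intro sum.cong prod.cong, auto)
  \<comment> \<open>The sign of a cardinality is spread over the edges, one factor for each
    edge.\<close>
  also have "\<dots> = (\<Sum>j\<in>Pi\<^sub>E E ?J. \<Prod>i = 1..k. \<Prod>e\<in>E. if j e \<le> i then -1 else 1)"
    using E by (intro sum.cong prod.cong refl) (simp add: prod.inter_filter[symmetric])
  also have "\<dots> = (\<Sum>j\<in>Pi\<^sub>E E ?J. \<Prod>e\<in>E. \<Prod>i = 1..k. if j e \<le> i then -1 else 1)"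
    by (subst prod.swap) (rule refl)
  also have "\<dots> = (\<Prod>e\<in>E. \<Sum>j\<in>?J e. \<Prod>i = 1..k. if j \<le> i then -1 else 1)"
    using E by (intro prod_sum_PiE[symmetric]) auto
  finally have "(-1 :: int) ^ (k * card E) *
      (\<Sum>B | B \<in> chain_tuples k E \<and> (\<forall>i\<in>{1..k}. {e \<in> E. p i e} \<subseteq> B i).
         \<Prod>i = 1..k. (-1) ^ card (B i)) =
      (\<Prod>e\<in>E. (-1) ^ k * (\<Sum>j\<in>?J e. \<Prod>i = 1..k. if j \<le> i then -1 else 1))"
    by (simp add: prod.distrib power_mult)
  also have "\<dots> = (\<Prod>e\<in>E. if odd (first_index k (\<lambda>i. p i e)) then 1 else 0)"
    by (intro prod.cong refl threshold_sum)
  also have "\<dots> = (if \<forall>e\<in>E. odd (first_index k (\<lambda>i. p i e)) then 1 else 0)"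
    using E by (auto simp: prod_zero_iff)
  finally show ?thesis .
qed

section \<open>Coupled flows and the chain Tutte polynomial\<close>

lemma finite_flows_on:
  assumes "finite D" "finite (carrier A)"
  shows "finite (flows_on V D A B)"
proof (rule finite_subset)
  show "flows_on V D A B \<subseteq> D \<rightarrow>\<^sub>E carrier A"
    by (auto simp: flows_on_def)
qed (use assms in \<open>intro finite_PiE, auto\<close>)

lemma finite_chain_tuples:
  assumes "finite E"
  shows "finite (chain_tuples k E)"
proof (rule finite_subset)
  show "chain_tuples k E \<subseteq> {1..k} \<rightarrow>\<^sub>E Pow E"
    by (auto simp: chain_tuples_def)
qed (use assms in \<open>intro finite_PiE, auto\<close>)

lemma chain_tuples_subset: "B \<in> chain_tuples k E \<Longrightarrow> i \<in> {1..k} \<Longrightarrow> B i \<subseteq> E"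
  by (auto simp: chain_tuples_def)

text \<open>The support is taken as a set of undirected edges, ready for comparison with the members
  of a chain.\<close>

definition flow_support ::
  "('v \<times> 'v) set \<Rightarrow> ('a, 'b) monoid_scheme \<Rightarrow> ('v \<times> 'v \<Rightarrow> 'a) \<Rightarrow> 'v set set" where
  "flow_support D A f = und ` {d \<in> D. f d \<noteq> \<one>\<^bsub>A\<^esub>}"

lemma flows_on_iff_support:
  assumes "und ` D = E" "B \<subseteq> E"
  shows "f \<in> flows_on V D A B \<longleftrightarrow> f \<in> flows_on V D A E \<and> flow_support D A f \<subseteq> B"
  using assms by (auto simp: flows_on_def flow_support_def)

lemma und_mem_flow_support:
  assumes "inj_on und D" "d \<in> D"
  shows "und d \<in> flow_support D A f \<longleftrightarrow> f d \<noteq> \<one>\<^bsub>A\<^esub>"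
  using assms by (auto simp: flow_support_def inj_on_def)

text \<open>At each arc the two coupling clauses are those of \<open>odd_first_index_iff\<close>,
  with nontriviality of \<open>f i\<close> as the predicate; \<open>und\<close> carries the
  condition from arcs to edges.\<close>

lemma coupled_flows_eq:
  assumes G: "simple_graph V E" and D: "orientation V E D"
  shows "coupled_flows k V D A =
    {f \<in> \<Pi>\<^sub>E i\<in>{1..k}. flows_on V D (A i) E.
       \<forall>e\<in>E. odd (first_index k (\<lambda>i. e \<in> flow_support D (A i) (f i)))}"
proof -
  have E: "und ` D = E" and inj: "inj_on und D"
    using bij_betw_und[OF G D] by (auto simp: bij_betw_def)
  have cond: "(\<forall>e\<in>E. odd (first_index k (\<lambda>i. e \<in> flow_support D (A i) (f i)))) \<longleftrightarrow>
      (\<forall>d\<in>D. odd (first_index k (\<lambda>i. f i d \<noteq> \<one>\<^bsub>A i\<^esub>)))" for f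
    unfolding E[symmetric] by (simp add: und_mem_flow_support[OF inj])
  have "flows_on V D (A i) E = {g \<in> D \<rightarrow>\<^sub>E carrier (A i). kirchhoff V D (A i) g}" for i
    using E by (auto simp: flows_on_def)
  then have flows: "f \<in> (\<Pi>\<^sub>E i\<in>{1..k}. flows_on V D (A i) E) \<longleftrightarrow>
      f \<in> (\<Pi>\<^sub>E i\<in>{1..k}. D \<rightarrow>\<^sub>E carrier (A i)) \<and> (\<forall>i\<in>{1..k}. kirchhoff V D (A i) (f i))" for f
    unfolding PiE_iff[of f] by auto
  show ?thesis
  proof (rule Set.set_eqI)
    fix f
    show "f \<in> coupled_flows k V D A \<longleftrightarrow> f \<in> {f \<in> \<Pi>\<^sub>E i\<in>{1..k}. flows_on V D (A i) E.
       \<forall>e\<in>E. odd (first_index k (\<lambda>i. e \<in> flow_support D (A i) (f i)))}"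
      unfolding coupled_flows_def mem_Collect_eq cond flows
      unfolding odd_first_index_iff not_not
      by (rule conj_assoc[symmetric])
  qed
qed

text \<open>Double counting of pairs of a chain \<open>B\<close> and a tuple of flows
  \<open>f\<close> whose supports lie in the members of \<open>B\<close>, weighted by the sign of
  \<open>B\<close>.\<close>

lemma flow_number_eq_chain_sum:
  fixes A :: "nat \<Rightarrow> ('a, 'b) monoid_scheme"
  assumes G: "simple_graph V E" and D: "orientation V E D"
    and A: "\<And>i. i \<in> {1..k} \<Longrightarrow> comm_group (A i)"
    and fin: "\<And>i. i \<in> {1..k} \<Longrightarrow> finite (carrier (A i))"
  shows "int (flow_number k V D A) = (-1) ^ (k * card E) *
    (\<Sum>B\<in>chain_tuples k E. \<Prod>i = 1..k.
       (-1) ^ card (B i) * int (order (A i)) ^ (card (B i) - rk V (B i)))"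
proof -
  let ?C = "chain_tuples k E" and ?X = "\<Pi>\<^sub>E i\<in>{1..k}. flows_on V D (A i) E"
  let ?R = "\<lambda>B f. \<forall>i\<in>{1..k}. flow_support D (A i) (f i) \<subseteq> B i"
  let ?s = "\<lambda>B. \<Prod>i = 1..k. (-1 :: int) ^ card (B i)"
  have E: "und ` D = E"
    using bij_betw_und[OF G D] by (simp add: bij_betw_def)
  have finE: "finite E" using G by (rule simple_graphD)
  have finX: "finite ?X"
    by (intro finite_PiE finite_atLeastAtMost finite_flows_on[OF orientation_finite[OF G D]] fin)
  \<comment> \<open>The powers of the group orders count tuples of flows, so each term becomes a
    constant sum over tuples.\<close>
  have summand: "(\<Prod>i = 1..k. (-1) ^ card (B i) * int (order (A i)) ^ (card (B i) - rk V (B i))) =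
      (\<Sum>f | f \<in> ?X \<and> ?R B f. ?s B)" if B: "B \<in> ?C" for B
  proof -
    have "(\<Prod>i = 1..k. int (order (A i)) ^ (card (B i) - rk V (B i))) =
        (\<Prod>i = 1..k. int (card (flows_on V D (A i) (B i))))"
    proof (rule prod.cong[OF refl])
      fix i assume i: "i \<in> {1..k}"
      show "int (order (A i)) ^ (card (B i) - rk V (B i)) =
          int (card (flows_on V D (A i) (B i)))"
        using comm_group.card_flows_on[OF A[OF i] G D chain_tuples_subset[OF B i]]
        by (simp only: of_nat_power)
    qed
    also have "\<dots> = int (card (\<Pi>\<^sub>E i\<in>{1..k}. flows_on V D (A i) (B i)))"
      by (simp only: card_PiE finite_atLeastAtMost of_nat_prod)
    also have "(\<Pi>\<^sub>E i\<in>{1..k}. flows_on V D (A i) (B i)) = {f. f \<in> ?X \<and> ?R B f}"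
    proof -
      have "(\<forall>i\<in>{1..k}. f i \<in> flows_on V D (A i) (B i)) \<longleftrightarrow>
          (\<forall>i\<in>{1..k}. f i \<in> flows_on V D (A i) E) \<and> ?R B f" for f
        unfolding ball_conj_distrib[symmetric]
        by (intro ball_cong refl flows_on_iff_support[OF E chain_tuples_subset[OF B]])
      then show ?thesis
        by (intro Set.set_eqI) (simp only: PiE_iff mem_Collect_eq conj_ac)
    qed
    finally show ?thesis by (simp add: prod.distrib)
  qed
  have "(-1) ^ (k * card E) * (\<Sum>B\<in>?C. \<Prod>i = 1..k.
       (-1) ^ card (B i) * int (order (A i)) ^ (card (B i) - rk V (B i))) =
      (-1) ^ (k * card E) * (\<Sum>B\<in>?C. \<Sum>f | f \<in> ?X \<and> ?R B f. ?s B)"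
    by (simp only: summand cong: sum.cong)
  \<comment> \<open>After the exchange, \<open>f\<close> is fixed and the inner sum is a signed sum
    over the chains that contain its supports.\<close>
  also have "\<dots> = (\<Sum>f\<in>?X. (-1) ^ (k * card E) * (\<Sum>B | B \<in> ?C \<and> ?R B f. ?s B))"
    by (subst sum.swap_restrict[OF finite_chain_tuples[OF finE] finX])
      (simp add: sum_distrib_left)
  also have "\<dots> = (\<Sum>f\<in>?X. if \<forall>e\<in>E. odd (first_index k (\<lambda>i. e \<in> flow_support D (A i) (f i)))
      then 1 else 0)"
  proof (rule sum.cong[OF refl])
    fix f
    have "{e \<in> E. e \<in> flow_support D (A i) (f i)} = flow_support D (A i) (f i)" for i
      using E by (auto simp: flow_support_def)
    then show "(-1) ^ (k * card E) * (\<Sum>B | B \<in> ?C \<and> ?R B f. ?s B) =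
        (if \<forall>e\<in>E. odd (first_index k (\<lambda>i. e \<in> flow_support D (A i) (f i))) then 1 else 0)"
      using signed_chain_sum[OF finE, of k "\<lambda>i e. e \<in> flow_support D (A i) (f i)"] by simp
  qed
  also have "\<dots> = int (card (coupled_flows k V D A))"
    unfolding coupled_flows_eq[OF G D] using finX
    by (simp only: sum.inter_filter[symmetric] sum_constant of_nat_mult mult_1_right)
  finally show ?thesis
    by (simp add: flow_number_def)
qed

text \<open>At these arguments every factor is a sign times a power of \<open>t i\<close>. With one
  more \<open>(-1) ^ rk V E\<close> per index, the exponents of -1 add up to the cardinality of
  \<open>B i\<close> modulo 2.\<close>

lemma chain_Tutte_graphic:
  assumes G: "simple_graph V E"
  shows "(-1) ^ (k * rk V E) * chain_Tutte k (graphic_matroid V E) (\<lambda>_. 0) (\<lambda>i. 1 - t i) =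
    (\<Sum>B\<in>chain_tuples k E. \<Prod>i = 1..k.
       (-1) ^ card (B i) * t i ^ (card (B i) - rk V (B i)) :: 'r :: comm_ring_1)"
proof -
  have factor: "(-1) ^ rk V E * ((0 - 1) ^ (rk V E - rk V B) *
      (1 - x - 1) ^ (card B - rk V B)) = (-1) ^ card B * x ^ (card B - rk V B)"
    if B: "B \<subseteq> E" for B and x :: 'r
  proof -
    \<comment> \<open>Writing the larger numbers as sums removes the truncated subtractions; the
      power \<open>m\<close> then occurs twice and cancels.\<close>
    obtain m where m: "rk V E = rk V B + m"
      using rk_mono[OF G B] by (auto simp: le_iff_add)
    obtain n where n: "card B = rk V B + n"
      using rk_le_card[OF G B] by (auto simp: le_iff_add)
    have "(1 - x - 1) ^ n = (-1) ^ n * x ^ n"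
      by (simp add: power_mult_distrib[symmetric])
    moreover have "(-1) ^ m * (-1) ^ m = (1 :: 'r)"
      by (simp add: power_mult_distrib[symmetric])
    ultimately show ?thesis
      by (simp add: m n power_add mult.assoc)
  qed
  show ?thesis
    unfolding chain_Tutte_def graphic_matroid_def prod.case sum_distrib_left
  proof (rule sum.cong[OF refl])
    fix B assume B: "B \<in> chain_tuples k E"
    \<comment> \<open>The global sign is distributed evenly over the \<open>k\<close>
      indices.\<close>
    have "(-1) ^ (k * rk V E) = (\<Prod>i = 1..k. (-1 :: 'r) ^ rk V E)"
      by (simp add: power_mult[symmetric] mult.commute)
    then show "(-1) ^ (k * rk V E) * (\<Prod>i = 1..k. (0 - 1) ^ (rk V E - rk V (B i)) *
        (1 - t i - 1) ^ (card (B i) - rk V (B i))) =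
      (\<Prod>i = 1..k. (-1) ^ card (B i) * t i ^ (card (B i) - rk V (B i)))"
      using factor[OF chain_tuples_subset[OF B]]
      by (simp only: prod.distrib[symmetric]) (intro prod.cong, auto)
  qed
qed

theorem theorem1p12:
  fixes V :: "'v set" and E :: "'v set set" and E' :: "('v \<times> 'v) set"
    and k :: nat and A :: "nat \<Rightarrow> ('a, 'b) monoid_scheme" and t :: "nat \<Rightarrow> nat"
  assumes "simple_graph V E"
    and "orientation V E E'"
    and "k \<ge> 1"
    and "\<And>i. i \<in> {1..k} \<Longrightarrow> comm_group (A i)"
    and "\<And>i. i \<in> {1..k} \<Longrightarrow> finite (carrier (A i))"
    and "\<And>i. i \<in> {1..k} \<Longrightarrow> card (carrier (A i)) = t i"
  shows "int (flow_number k V E' A) =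
           (-1) ^ (k * card E) *
           (\<Sum>B\<in>chain_tuples k E. \<Prod>i = 1..k. (-1) ^ card (B i) * int (t i) ^ (card (B i) - rk V (B i)))
       \<and> (-1) ^ (k * card E) *
           (\<Sum>B\<in>chain_tuples k E. \<Prod>i = 1..k. (-1) ^ card (B i) * int (t i) ^ (card (B i) - rk V (B i))) =
         (-1) ^ (k * (card E + rk V E)) *
           chain_Tutte k (graphic_matroid V E) (\<lambda>_. 0) (\<lambda>i. 1 - int (t i))"
proof
  have "(\<Sum>B\<in>chain_tuples k E. \<Prod>i = 1..k.
      (-1) ^ card (B i) * int (order (A i)) ^ (card (B i) - rk V (B i))) =
    (\<Sum>B\<in>chain_tuples k E. \<Prod>i = 1..k.
      (-1) ^ card (B i) * int (t i) ^ (card (B i) - rk V (B i)))"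
    using assms(6) by (intro sum.cong prod.cong) (auto simp: order_def)
  then show "int (flow_number k V E' A) = (-1) ^ (k * card E) *
      (\<Sum>B\<in>chain_tuples k E. \<Prod>i = 1..k.
         (-1) ^ card (B i) * int (t i) ^ (card (B i) - rk V (B i)))"
    using flow_number_eq_chain_sum[of V E E' k A] assms by simp
  show "(-1) ^ (k * card E) *
      (\<Sum>B\<in>chain_tuples k E. \<Prod>i = 1..k.
         (-1) ^ card (B i) * int (t i) ^ (card (B i) - rk V (B i))) =
    (-1) ^ (k * (card E + rk V E)) *
      chain_Tutte k (graphic_matroid V E) (\<lambda>_. 0) (\<lambda>i. 1 - int (t i))"
    \<comment> \<open>The chain sum is replaced by the Tutte value with its sign, leaving an
      identity between powers of -1.\<close>
    unfolding chain_Tutte_graphic[OF assms(1), of k "\<lambda>i. int (t i)", symmetric]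
    by (simp add: distrib_left power_add mult.assoc)
qed

end
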